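(* Let $m\ge 1$, let $n_1,\ldots,n_m$ be positive integers and set $n_{m+1}=n_1$. For every integer $j$ with $0\leq j\leq m-1$, the expression $$S(n_1,\ldots,n_m;j,q):={n_1+n_m\brack n_1}^{-1}\sum_{k=-n_1}^{n_1}(-1)^k q^{jk^2+\binom{k}{2}}\prod_{i=1}^m {n_i+n_{i+1}\brack n_i+k}$$ is a polynomial in $q$ with nonnegative integer coefficients.
   Context: For an integer $n\ge 0$, $(q)_n=(1-q)(1-q^2)\cdots(1-q^n)$ (with $(q)_0=1$), and $1/(q)_n=0$ for $n<0$. The $q$-binomial coefficient is ${n\brack k}=\frac{(q)_n}{(q)_k(q)_{n-k}}$, so that ${n\brack k}=0$ if $k>n$ or $k<0$. *)

theory Defs
  imports "HOL-Computational_Algebra.Computational_Algebra"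
begin

text \<open>
  All expressions live in the field of fractions of the polynomial ring \<open>\<int>[q]\<close>; the
  indeterminate \<open>q\<close> is \<open>qvar\<close>.
\<close>

type_synonym ratfun = "int poly fract"

definition qvar :: ratfun where
  "qvar = to_fract [:0, 1:]"

definition qfact :: "nat \<Rightarrow> ratfun" where
  "qfact n = (\<Prod>i=1..n. 1 - qvar ^ i)"

text \<open>\<open>inv_qfact\<close> is \<open>1 / (q)\<^sub>n\<close>, extended by \<open>0\<close> to negative \<open>n\<close>.\<close>

definition inv_qfact :: "int \<Rightarrow> ratfun" where
  "inv_qfact n = (if n < 0 then 0 else 1 / qfact (nat n))"

definition qbinom :: "nat \<Rightarrow> int \<Rightarrow> ratfun" where
  "qbinom n k = qfact n * inv_qfact k * inv_qfact (int n - k)"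

text \<open>
  Only the entries \<open>n 1, \<dots>, n (m + 1)\<close> of the sequence are used; the cyclic convention
  \<open>n (m + 1) = n 1\<close> is not built in.  The integer \<open>k * (k - 1) div 2\<close> is the
  binomial coefficient \<open>k\<close> over \<open>2\<close>, also for negative \<open>k\<close>.
\<close>

definition S :: "nat \<Rightarrow> (nat \<Rightarrow> nat) \<Rightarrow> nat \<Rightarrow> ratfun" where
  "S m n j =
     inverse (qbinom (n 1 + n m) (int (n 1))) *
     (\<Sum>k = - int (n 1)..int (n 1).
        (- 1) powi k * qvar powi (int j * k ^ 2 + k * (k - 1) div 2) *
        (\<Prod>i=1..m. qbinom (n i + n (i + 1)) (int (n i) + k)))"

end

theory Submission
  imports Defs
begin

text \<open>
  Up to the factors \<open>(q)\<close> of sums of neighbouring entries, \<open>S\<close> is the alternating sum of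
  \<open>\<Prod>\<^sub>i 1 / ((q)\<^bsub>n\<^sub>i+k\<^esub> (q)\<^bsub>n\<^sub>i-k\<^esub>)\<close>, because the product of \<open>q\<close>-binomials is cyclic.
  The \<open>q\<close>-Vandermonde identity rewrites the two factors belonging to \<open>n\<^sub>1\<close> and \<open>n\<^sub>2\<close> as a
  positive combination, over \<open>0 \<le> s \<le> n\<^sub>1\<close>, of the single factors belonging to \<open>s\<close>.  For \<open>m \<ge> 3\<close> this gives
  \<open>S (n\<^sub>1, \<dots>, n\<^sub>m; j) = \<Sum>\<^sub>s w\<^sub>s [n\<^sub>1, s] [n\<^sub>2 + n\<^sub>3, n\<^sub>2 - s] S (s, n\<^sub>3, \<dots>, n\<^sub>m; j')\<close>
  with \<open>[n, k]\<close> the \<open>q\<close>-binomial coefficient.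
  Of the two forms of \<open>q\<close>-Vandermonde, one has \<open>w\<^sub>s = q^(s\<^sup>2)\<close>, \<open>j' = j - 1\<close> and serves
  \<open>j > 0\<close>; the other has \<open>w\<^sub>s = q^((n\<^sub>1 - s)(n\<^sub>2 - s))\<close>, \<open>j' = j\<close> and serves \<open>j = 0\<close>.  The
  induction ends at \<open>m = 1\<close>, \<open>j = 0\<close>, where the sum is \<open>1\<close> or \<open>0\<close>.
\<close>

section \<open>Powers of \<open>q\<close>, \<open>q\<close>-factorials and Pascal's rules\<close>

lemma qvar_power: "qvar ^ i = to_fract (monom 1 i)"
proof (induction i)
  case (Suc i)
  have "monom 1 (Suc i) = [:0, 1:] * (monom 1 i :: int poly)"
    by (simp add: monom_Suc)
  then show ?case
    using Suc by (simp only: power_Suc to_fract_mult qvar_def)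
qed (simp add: one_poly_eq_simps)

lemma qvar_nonzero [simp]: "qvar \<noteq> 0"
  by (simp add: qvar_def)

lemma qvar_power_neq_1 [simp]:
  assumes "i > 0"
  shows "qvar ^ i \<noteq> 1"
proof
  assume "qvar ^ i = 1"
  then have "to_fract (monom 1 i) = to_fract (1 :: int poly)"
    by (simp add: qvar_power)
  then have "monom 1 i = (1 :: int poly)"
    by (simp only: to_fract_eq_iff)
  then have "degree (monom (1::int) i) = degree (1 :: int poly)"
    by simp
  with assms show False
    by (simp add: degree_monom_eq)
qed

lemma qfact_0 [simp]: "qfact 0 = 1"
  by (simp add: qfact_def)

lemma qfact_Suc: "qfact (Suc n) = qfact n * (1 - qvar ^ Suc n)"
  by (simp add: qfact_def prod.nat_ivl_Suc')

lemma qfact_nonzero [simp]: "qfact n \<noteq> 0"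
  unfolding qfact_def by (subst prod_zero_iff) (auto simp: eq_commute [of 1])

lemma inv_qfact_of_nat [simp]: "inv_qfact (int n) = 1 / qfact n"
  by (simp add: inv_qfact_def)

lemma inv_qfact_neg: "k < 0 \<Longrightarrow> inv_qfact k = 0"
  by (simp add: inv_qfact_def)

text \<open>At \<open>k = 0\<close> the factor \<open>1 - q^0\<close> matches the value
  \<open>0\<close> at \<open>-1\<close>, so the recurrence, and with it Pascal's rule, holds for
  every integer \<open>k\<close>.\<close>

lemma inv_qfact_minus_one: "inv_qfact (k - 1) = (1 - qvar powi k) * inv_qfact k"
proof (cases "k > 0")
  case True
  then obtain n where k: "k = int (Suc n)"
    by (metis gr0_conv_Suc pos_int_cases)
  then have "k - 1 = int n"
    by simp
  moreover have "qvar powi k = qvar ^ Suc n" "inv_qfact k = 1 / qfact (Suc n)"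
    unfolding k by (rule power_int_of_nat inv_qfact_of_nat)+
  ultimately show ?thesis
    by (simp add: qfact_Suc del: power_Suc)
next
  case False
  then show ?thesis
    by (cases "k = 0") (simp_all add: inv_qfact_neg)
qed

text \<open>After a common factor is split off, this is
  \<open>(1 - q^k) + q^k (1 - q^(n+1-k)) = 1 - q^(n+1)\<close>.\<close>

lemma qbinom_Suc:
  "qbinom (Suc n) k = qbinom n (k - 1) + qvar powi k * qbinom n k"
proof -
  define a where "a = inv_qfact k * inv_qfact (int (Suc n) - k)"
  have 1: "qbinom n (k - 1) = qfact n * (1 - qvar powi k) * a"
    by (simp add: qbinom_def inv_qfact_minus_one a_def algebra_simps)
  have "inv_qfact (int n - k) = (1 - qvar powi (int (Suc n) - k)) * inv_qfact (int (Suc n) - k)"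
    by (subst inv_qfact_minus_one [symmetric]) simp
  then have 2: "qbinom n k = qfact n * (1 - qvar powi (int (Suc n) - k)) * a"
    by (simp add: qbinom_def a_def)
  have 3: "qvar powi k * qvar powi (int (Suc n) - k) = qvar ^ Suc n"
    by (subst power_int_add [symmetric]) (simp_all flip: power_int_of_nat)
  have "qbinom (Suc n) k = qfact n * (1 - qvar ^ Suc n) * a"
    by (simp add: qbinom_def a_def qfact_Suc del: power_Suc)
  then show ?thesis
    unfolding 1 2 3 [symmetric] by (simp add: algebra_simps)
qed

lemma qbinom_sym: "qbinom n (int n - k) = qbinom n k"
  by (simp add: qbinom_def)

lemma qbinom_Suc':
  "qbinom (Suc n) k = qvar powi (int (Suc n) - k) * qbinom n (k - 1) + qbinom n k"
proof -
  have "qbinom n (int (Suc n) - k) = qbinom n (k - 1)"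
    using qbinom_sym [of n "k - 1"] by (simp add: algebra_simps)
  moreover have "qbinom n (int (Suc n) - k - 1) = qbinom n k"
    using qbinom_sym [of n k] by (simp add: algebra_simps)
  ultimately show ?thesis
    using qbinom_Suc [of n "int (Suc n) - k"] qbinom_sym [of "Suc n" k] by simp
qed

lemma qbinom_eq_0: "k < 0 \<or> k > int n \<Longrightarrow> qbinom n k = 0"
  by (auto simp: qbinom_def inv_qfact_neg)

lemma qbinom_0 [simp]: "qbinom 0 k = (if k = 0 then 1 else 0)"
  using qbinom_eq_0 [of k 0] by (auto simp: qbinom_def inv_qfact_def)

section \<open>Two forms of the \<open>q\<close>-Vandermonde identity\<close>

lemma sum_qbinom_atMost_Suc:
  "(\<Sum>t\<le>Suc a. f t * qbinom a (int t - 1)) = (\<Sum>t\<le>a. f (Suc t) * qbinom a (int t))"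
  "(\<Sum>t\<le>Suc a. f t * qbinom a (int t)) = (\<Sum>t\<le>a. f t * qbinom a (int t))"
proof -
  show "(\<Sum>t\<le>Suc a. f t * qbinom a (int t - 1)) = (\<Sum>t\<le>a. f (Suc t) * qbinom a (int t))"
    by (subst sum.atMost_Suc_shift) (simp add: qbinom_eq_0)
  show "(\<Sum>t\<le>Suc a. f t * qbinom a (int t)) = (\<Sum>t\<le>a. f t * qbinom a (int t))"
    by (simp add: qbinom_eq_0)
qed

text \<open>\<open>qbinom_Suc\<close> splits \<open>[a+1, t]\<close>; after an index shift
  \<open>qbinom_Suc'\<close> recombines the terms into \<open>[b+1, c-t]\<close>, so each step moves
  one unit from \<open>a\<close> to \<open>b\<close>. A negative exponent occurs only where
  \<open>[b, c-t]\<close> vanishes.\<close>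

lemma q_vandermonde:
  "qbinom (a + b) c =
    (\<Sum>t\<le>a. qvar powi (int t * (int b - c + int t)) * qbinom a (int t) * qbinom b (c - int t))"
proof (induction a arbitrary: b)
  case (Suc a)
  define f where "f t = qvar powi (int t * (int b - c + int t)) * qbinom b (c - int t)" for t
  have "(\<Sum>t\<le>Suc a. qvar powi (int t * (int b - c + int t)) * qbinom (Suc a) (int t) * qbinom b (c - int t))
     = (\<Sum>t\<le>Suc a. f t * qbinom a (int t - 1)) + (\<Sum>t\<le>Suc a. (f t * qvar powi int t) * qbinom a (int t))"
    unfolding sum.distrib [symmetric] f_def
    by (rule sum.cong) (simp_all add: qbinom_Suc algebra_simps)
  also have "\<dots> = (\<Sum>t\<le>a. f (Suc t) * qbinom a (int t) + f t * qvar powi int t * qbinom a (int t))"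
    unfolding sum_qbinom_atMost_Suc sum.distrib ..
  also have "\<dots> = (\<Sum>t\<le>a. qvar powi (int t * (int (Suc b) - c + int t)) * qbinom a (int t) * qbinom (Suc b) (c - int t))"
  proof (rule sum.cong [OF refl])
    fix t
    define x where "x = qvar powi (int t * (int (Suc b) - c + int t))"
    have 1: "f (Suc t) = x * qvar powi (int (Suc b) - (c - int t)) * qbinom b (c - int t - 1)"
      by (simp add: f_def x_def algebra_simps flip: power_int_add)
    have 2: "f t * qvar powi int t = x * qbinom b (c - int t)"
      unfolding f_def x_def
      by (simp add: algebra_simps flip: power_int_add power_int_of_nat)
    show "f (Suc t) * qbinom a (int t) + f t * qvar powi int t * qbinom a (int t) =
       x * qbinom a (int t) * qbinom (Suc b) (c - int t)"
      unfolding 1 2 qbinom_Suc' by (simp add: algebra_simps)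
  qed
  also have "\<dots> = qbinom (a + Suc b) c"
    by (rule Suc [symmetric])
  finally show ?case
    by simp
qed auto

text \<open>The same induction with the two Pascal rules interchanged, which produces the other
  exponent.\<close>

lemma q_vandermonde':
  "qbinom (a + b) c =
    (\<Sum>t\<le>a. qvar powi ((int a - int t) * (c - int t)) * qbinom a (int t) * qbinom b (c - int t))"
proof (induction a arbitrary: b)
  case (Suc a)
  define f where "f t = qvar powi ((int (Suc a) - int t) * (c - int t)) * qbinom b (c - int t)" for t
  have "(\<Sum>t\<le>Suc a. qvar powi ((int (Suc a) - int t) * (c - int t)) * qbinom (Suc a) (int t) * qbinom b (c - int t))
     = (\<Sum>t\<le>Suc a. (f t * qvar powi (int (Suc a) - int t)) * qbinom a (int t - 1)) + (\<Sum>t\<le>Suc a. f t * qbinom a (int t))"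
    unfolding sum.distrib [symmetric] f_def
    by (rule sum.cong) (simp_all only: qbinom_Suc' algebra_simps)
  also have "\<dots> = (\<Sum>t\<le>a. f (Suc t) * qvar powi (int (Suc a) - int (Suc t)) * qbinom a (int t) + f t * qbinom a (int t))"
    unfolding sum_qbinom_atMost_Suc sum.distrib ..
  also have "\<dots> = (\<Sum>t\<le>a. qvar powi ((int a - int t) * (c - int t)) * qbinom a (int t) * qbinom (Suc b) (c - int t))"
  proof (rule sum.cong [OF refl])
    fix t
    define x where "x = qvar powi ((int a - int t) * (c - int t))"
    have 1: "f (Suc t) * qvar powi (int (Suc a) - int (Suc t)) = x * qbinom b (c - int t - 1)"
      by (simp add: f_def x_def algebra_simps flip: power_int_add)
    have 2: "f t = x * qvar powi (c - int t) * qbinom b (c - int t)"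
      unfolding f_def x_def by (simp add: algebra_simps flip: power_int_add)
    show "f (Suc t) * qvar powi (int (Suc a) - int (Suc t)) * qbinom a (int t) + f t * qbinom a (int t) =
       x * qbinom a (int t) * qbinom (Suc b) (c - int t)"
      unfolding 1 2 qbinom_Suc by (simp add: algebra_simps)
  qed
  also have "\<dots> = qbinom (a + Suc b) c"
    by (rule Suc [symmetric])
  finally show ?case
    by simp
qed auto

section \<open>Polynomials with nonnegative coefficients inside the fraction field\<close>

definition nonneg_polys :: "ratfun set" where
  "nonneg_polys = {to_fract p | p. \<forall>i. coeff p i \<ge> 0}"

lemma nonneg_polys_0 [intro]: "0 \<in> nonneg_polys"
  unfolding nonneg_polys_def by (rule CollectI, rule exI [of _ 0]) simp

lemma nonneg_polys_1 [intro]: "1 \<in> nonneg_polys"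
  unfolding nonneg_polys_def by (rule CollectI, rule exI [of _ 1]) (simp add: coeff_1)

lemma nonneg_polys_add [intro]:
  assumes "x \<in> nonneg_polys" "y \<in> nonneg_polys"
  shows "x + y \<in> nonneg_polys"
proof -
  obtain p r where "x = to_fract p" "y = to_fract r" "\<forall>i. coeff p i \<ge> 0" "\<forall>i. coeff r i \<ge> 0"
    using assms by (auto simp: nonneg_polys_def)
  then show ?thesis
    unfolding nonneg_polys_def by (intro CollectI exI [of _ "p + r"]) simp
qed

lemma nonneg_polys_mult [intro]:
  assumes "x \<in> nonneg_polys" "y \<in> nonneg_polys"
  shows "x * y \<in> nonneg_polys"
proof -
  obtain p r where "x = to_fract p" "y = to_fract r" "\<forall>i. coeff p i \<ge> 0" "\<forall>i. coeff r i \<ge> 0"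
    using assms by (auto simp: nonneg_polys_def)
  then show ?thesis
    unfolding nonneg_polys_def
    by (intro CollectI exI [of _ "p * r"]) (simp add: coeff_mult sum_nonneg)
qed

lemma nonneg_polys_sum [intro]:
  "(\<And>i. i \<in> A \<Longrightarrow> f i \<in> nonneg_polys) \<Longrightarrow> sum f A \<in> nonneg_polys"
  by (induction A rule: infinite_finite_induct) auto

lemma nonneg_polys_qvar_power [intro]: "qvar ^ i \<in> nonneg_polys"
  unfolding nonneg_polys_def qvar_power by (intro CollectI exI [of _ "monom 1 i"]) simp

lemma nonneg_polys_qbinom [intro]: "qbinom n k \<in> nonneg_polys"
proof (induction n arbitrary: k)
  case (Suc n)
  show ?case
  \<comment> \<open>For \<open>k < 0\<close> the factor \<open>q^k\<close> in Pascal's rule is not a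
    polynomial, but there the binomial is zero.\<close>
  proof (cases "k < 0")
    case False
    then have "qvar powi k \<in> nonneg_polys"
      by (auto simp: power_int_def)
    with Suc show ?thesis
      by (auto simp: qbinom_Suc)
  qed (auto simp: qbinom_eq_0)
qed auto

section \<open>Merging the factors of two neighbouring entries\<close>

text \<open>The share of one entry in the cyclic product: the first factor comes from its own
  binomial, the second from the preceding one.\<close>

definition sym_inv :: "nat \<Rightarrow> int \<Rightarrow> ratfun" where
  "sym_inv a k = inv_qfact (int a + k) * inv_qfact (int a - k)"

lemma sym_inv_minus: "sym_inv a (- k) = sym_inv a k"
  by (simp add: sym_inv_def)

lemma sym_inv_eq_0: "\<bar>k\<bar> > int a \<Longrightarrow> sym_inv a k = 0"
  by (auto simp: sym_inv_def inv_qfact_neg abs_if split: if_splits)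

text \<open>Multiplying Vandermonde for \<open>[a+b, b-l]\<close> by \<open>c\<close> completes the
  left side; on the right \<open>(q)_(a-l)\<close> and \<open>(q)_(b+l)\<close> cancel, and
  \<open>s = t + l\<close> collects the rest into \<open>sym_inv s l\<close>. The weight
  \<open>w\<close> stays open to cover both forms.\<close>

lemma sym_inv_merge_nat:
  assumes "l \<le> a" "l \<le> b"
    and vandermonde: "qbinom (a - l + (b + l)) (int b - int l) =
      (\<Sum>t\<le>a - l. w (t + l) * qbinom (a - l) (int t) * qbinom (b + l) (int b - int l - int t))"
  shows "qfact (a + b) * sym_inv a (int l) * sym_inv b (int l) =
    (\<Sum>s\<le>a. w s * inv_qfact (int a - int s) * inv_qfact (int b - int s) * sym_inv s (int l))"
    (is "_ = sum ?g _")
proof -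
  define c where "c = inv_qfact (int a - int l) * inv_qfact (int b + int l)"
  have inv: "qfact (a - l) * inv_qfact (int a - int l) = 1"
    "qfact (b + l) * inv_qfact (int b + int l) = 1"
    using assms by (simp_all add: inv_qfact_def nat_add_distrib nat_diff_distrib)
  have "qfact (a + b) * sym_inv a (int l) * sym_inv b (int l) =
      qbinom (a - l + (b + l)) (int b - int l) * c"
    using assms(1) by (simp add: sym_inv_def qbinom_def c_def algebra_simps)
  also have "\<dots> = (\<Sum>t\<le>a - l. ?g (t + l))"
    unfolding vandermonde sum_distrib_right
  proof (rule sum.cong [OF refl])
    fix t
    have "qbinom (a - l) (int t) * qbinom (b + l) (int b - int l - int t) * c =
        (qfact (a - l) * inv_qfact (int a - int l)) * (qfact (b + l) * inv_qfact (int b + int l)) *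
        (inv_qfact (int t) * inv_qfact (int (a - l) - int t) *
         inv_qfact (int b - int l - int t) * inv_qfact (int (b + l) - (int b - int l - int t)))"
      by (simp only: qbinom_def c_def mult_ac)
    also have "\<dots> = inv_qfact (int a - int (t + l)) * inv_qfact (int b - int (t + l)) * sym_inv (t + l) (int l)"
      unfolding inv using assms(1)
      by (simp add: sym_inv_def algebra_simps of_nat_diff del: inv_qfact_of_nat)
    finally show "w (t + l) * qbinom (a - l) (int t) * qbinom (b + l) (int b - int l - int t) * c = ?g (t + l)"
      by (simp only: mult.assoc)
  qed
  also have "\<dots> = (\<Sum>s\<in>{l..a}. ?g s)"
    using assms(1)
    by (intro sum.reindex_bij_witness [of _ "\<lambda>s. s - l" "\<lambda>t. t + l"]) auto
  also have "\<dots> = sum ?g {..a}"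
    by (rule sum.mono_neutral_left) (auto simp: sym_inv_eq_0)
  finally show ?thesis .
qed

text \<open>Evenness reduces to \<open>l = |k|\<close>. If \<open>l\<close> exceeds \<open>a\<close>
  or \<open>b\<close>, both sides vanish: \<open>s < l\<close> kills \<open>sym_inv s l\<close>, and
  \<open>l \<le> s \<le> a\<close> forces \<open>s > b\<close>.\<close>

lemma sym_inv_merge:
  fixes w :: "nat \<Rightarrow> nat \<Rightarrow> ratfun"
  assumes "\<And>l. l \<le> a \<Longrightarrow> l \<le> b \<Longrightarrow> qbinom (a - l + (b + l)) (int b - int l) =
      (\<Sum>t\<le>a - l. w l (t + l) * qbinom (a - l) (int t) * qbinom (b + l) (int b - int l - int t))"
  shows "qfact (a + b) * sym_inv a k * sym_inv b k =
    (\<Sum>s\<le>a. w (nat \<bar>k\<bar>) s * inv_qfact (int a - int s) * inv_qfact (int b - int s) * sym_inv s k)"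
proof -
  define l where "l = nat \<bar>k\<bar>"
  have sym: "sym_inv s k = sym_inv s (int l)" for s
    by (cases "k \<ge> 0") (simp_all add: l_def sym_inv_minus)
  show ?thesis
  proof (cases "l \<le> a \<and> l \<le> b")
    case True
    then show ?thesis
      unfolding sym l_def [symmetric] by (intro sym_inv_merge_nat assms) auto
  next
    case False
    then have "qfact (a + b) * sym_inv a (int l) * sym_inv b (int l) = 0"
      by (auto simp: sym_inv_eq_0)
    moreover have "w l s * inv_qfact (int a - int s) * inv_qfact (int b - int s) * sym_inv s (int l) = 0"
      if "s \<le> a" for s
      using False that by (cases "s < l") (auto simp: sym_inv_eq_0 inv_qfact_neg)
    ultimately show ?thesis
      unfolding sym l_def [symmetric] by (simp add: sum.neutral del: mult_eq_0_iff)
  qed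
qed

text \<open>With \<open>s = t + l\<close> the exponent \<open>t (t + 2 l)\<close> is
  \<open>s^2 - l^2\<close>; the part \<open>q^(-k^2)\<close> will lower \<open>j\<close> by
  one.\<close>

lemma sym_inv_merge_shift:
  "qfact (a + b) * sym_inv a k * sym_inv b k =
    (\<Sum>s\<le>a. qvar powi (int (s ^ 2) - k ^ 2) * inv_qfact (int a - int s) * inv_qfact (int b - int s) * sym_inv s k)"
proof -
  have "int t * (int (b + l) - (int b - int l) + int t) = int ((t + l) ^ 2) - int l ^ 2" for t l
    by (simp add: power2_eq_square algebra_simps)
  then have "qbinom (a - l + (b + l)) (int b - int l) =
      (\<Sum>t\<le>a - l. qvar powi (int ((t + l) ^ 2) - int l ^ 2) *
        qbinom (a - l) (int t) * qbinom (b + l) (int b - int l - int t))" for l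
    unfolding q_vandermonde by presburger
  from sym_inv_merge [of a b "\<lambda>l s. qvar powi (int (s ^ 2) - int l ^ 2)" k, OF this]
  show ?thesis
    by simp
qed

text \<open>Here the exponent becomes \<open>(a - s) (b - s)\<close>, free of \<open>k\<close>, so
  \<open>j\<close> will stay as it is.\<close>

lemma sym_inv_merge_noshift:
  "qfact (a + b) * sym_inv a k * sym_inv b k =
    (\<Sum>s\<le>a. qvar powi ((int a - int s) * (int b - int s)) *
       inv_qfact (int a - int s) * inv_qfact (int b - int s) * sym_inv s k)"
proof (rule sym_inv_merge)
  fix l assume "l \<le> a" "l \<le> b"
  then show "qbinom (a - l + (b + l)) (int b - int l) =
      (\<Sum>t\<le>a - l. qvar powi ((int a - int (t + l)) * (int b - int (t + l))) *
        qbinom (a - l) (int t) * qbinom (b + l) (int b - int l - int t))"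
    unfolding q_vandermonde' by (simp add: of_nat_diff algebra_simps)
qed

section \<open>Alternating sums and their recurrences\<close>

definition sign_weight :: "nat \<Rightarrow> int \<Rightarrow> ratfun" where
  "sign_weight j k = (- 1) powi k * qvar powi (int j * k ^ 2 + k * (k - 1) div 2)"

lemma sign_weight_Suc: "sign_weight (Suc j) k = sign_weight j k * qvar powi (k ^ 2)"
  by (simp add: sign_weight_def algebra_simps flip: power_int_add)

text \<open>\<open>S\<close> without its \<open>q\<close>-factorial numerators. The entry
  \<open>a\<close> stands apart from the list because a merge absorbs the head of the list into
  it.\<close>

definition alt_sum :: "nat \<Rightarrow> nat list \<Rightarrow> nat \<Rightarrow> ratfun" where
  "alt_sum a ns j =
    (\<Sum>k = - int a..int a. sign_weight j k * sym_inv a k * (\<Prod>b\<leftarrow>ns. sym_inv b k))"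

text \<open>\<open>u\<close> is the part of the merge weight that depends on \<open>k\<close> and is
  absorbed by the sign weight; the rest leaves the inner sum once the sums are interchanged.\<close>

lemma alt_sum_merge:
  assumes "\<And>k. qfact (a + b) * sym_inv a k * sym_inv b k =
      (\<Sum>s\<le>a. u k * w s * inv_qfact (int a - int s) * inv_qfact (int b - int s) * sym_inv s k)"
    and "\<And>k. sign_weight j k * u k = sign_weight j' k"
  shows "qfact (a + b) * alt_sum a (b # ns) j =
    (\<Sum>s\<le>a. w s * inv_qfact (int a - int s) * inv_qfact (int b - int s) * alt_sum s ns j')"
proof -
  define h where "h k = (\<Prod>b\<leftarrow>ns. sym_inv b k)" for k
  define c where "c s = w s * inv_qfact (int a - int s) * inv_qfact (int b - int s)" for s
  have "qfact (a + b) * alt_sum a (b # ns) j =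
      (\<Sum>k = - int a..int a. sign_weight j k * h k * (qfact (a + b) * sym_inv a k * sym_inv b k))"
    by (simp add: alt_sum_def h_def sum_distrib_left mult_ac)
  also have "\<dots> = (\<Sum>k = - int a..int a. \<Sum>s\<le>a. c s * ((sign_weight j k * u k) * sym_inv s k * h k))"
    unfolding assms(1) c_def by (simp only: sum_distrib_left mult_ac)
  also have "\<dots> = (\<Sum>s\<le>a. \<Sum>k = - int a..int a. c s * (sign_weight j' k * sym_inv s k * h k))"
    unfolding assms(2) by (rule sum.swap)
  also have "\<dots> = (\<Sum>s\<le>a. c s * alt_sum s ns j')"
  \<comment> \<open>Since \<open>sym_inv s k\<close> is zero for \<open>|k| > s\<close>, the range
    fixed by \<open>a\<close> serves every \<open>s \<le> a\<close>.\<close>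
  proof (rule sum.cong [OF refl])
    fix s assume "s \<in> {..a}"
    then have "alt_sum s ns j' = (\<Sum>k = - int a..int a. sign_weight j' k * sym_inv s k * h k)"
      unfolding alt_sum_def h_def
      by (intro sum.mono_neutral_left) (auto simp: sym_inv_eq_0)
    then show "(\<Sum>k = - int a..int a. c s * (sign_weight j' k * sym_inv s k * h k)) = c s * alt_sum s ns j'"
      by (simp add: sum_distrib_left)
  qed
  finally show ?thesis
    by (simp add: c_def)
qed

lemma alt_sum_merge_shift:
  "qfact (a + b) * alt_sum a (b # ns) (Suc j) =
    (\<Sum>s\<le>a. qvar ^ (s ^ 2) * inv_qfact (int a - int s) * inv_qfact (int b - int s) * alt_sum s ns j)"
proof (rule alt_sum_merge [where u = "\<lambda>k. qvar powi (- (k ^ 2))"])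
  fix k :: int
  have "qvar powi (int (s ^ 2) - k ^ 2) = qvar powi (- (k ^ 2)) * qvar ^ (s ^ 2)" for s
    by (simp flip: power_int_of_nat power_int_add)
  then show "qfact (a + b) * sym_inv a k * sym_inv b k =
      (\<Sum>s\<le>a. qvar powi (- (k ^ 2)) * qvar ^ (s ^ 2) *
        inv_qfact (int a - int s) * inv_qfact (int b - int s) * sym_inv s k)"
    unfolding sym_inv_merge_shift by presburger
  show "sign_weight (Suc j) k * qvar powi (- (k ^ 2)) = sign_weight j k"
    by (simp add: sign_weight_Suc mult.assoc flip: power_int_add)
qed

lemma alt_sum_merge_noshift:
  "qfact (a + b) * alt_sum a (b # ns) j =
    (\<Sum>s\<le>a. qvar powi ((int a - int s) * (int b - int s)) *
      inv_qfact (int a - int s) * inv_qfact (int b - int s) * alt_sum s ns j)"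
  by (rule alt_sum_merge [where u = "\<lambda>_. 1"]) (simp_all add: sym_inv_merge_noshift)

section \<open>The base case of a single entry\<close>

text \<open>For \<open>a > 0\<close> this is, up to the factor \<open>(q)_(2a)\<close>, the finite
  \<open>q\<close>-binomial theorem at a point where its product has a zero factor.\<close>

lemma alt_sum_single: "alt_sum a [] 0 = (if a = 0 then 1 else 0)"
proof (cases "a = 0")
  case True
  then show ?thesis
    by (simp add: alt_sum_def sign_weight_def sym_inv_def inv_qfact_def)
next
  case False
  define f where "f k = sign_weight 0 k * sym_inv a k" for k
  \<comment> \<open>\<open>g\<close> vanishes at \<open>k = -a\<close> and at
    \<open>k = a + 1\<close>, where an \<open>inv_qfact\<close> has argument \<open>-1\<close>;
    hence its differences sum to zero.\<close>
  define g where "g k = sign_weight 0 k * inv_qfact (int a + k - 1) * inv_qfact (int a - k)" for k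
  have shift: "sign_weight 0 (k + 1) = - (sign_weight 0 k * qvar powi k)" for k
  proof -
    \<comment> \<open>Writing the increment as \<open>k * 2\<close> lets \<open>div 2\<close> be
      evaluated without a parity split.\<close>
    have "(k + 1) * (k + 1 - 1) = k * (k - 1) + k * 2"
      by (simp add: algebra_simps)
    then have "(k + 1) * (k + 1 - 1) div 2 = k * (k - 1) div 2 + k"
      by simp
    then show ?thesis
      by (simp add: sign_weight_def power_int_add del: power_int_minus_one_mult_self)
  qed
  have reflect: "sign_weight 0 (- k) = sign_weight 0 k * qvar powi k" for k
  proof -
    have "(- k) * (- k - 1) = k * (k - 1) + k * 2"
      by (simp add: algebra_simps)
    then have "(- k) * (- k - 1) div 2 = k * (k - 1) div 2 + k"
      by simp
    then show ?thesis
      by (simp add: sign_weight_def power_int_add power_int_minus flip: power_int_inverse)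
  qed
  \<comment> \<open>The summand \<open>f\<close> itself does not telescope, but its symmetrisation under \<open>k \<mapsto> - k\<close> does.\<close>
  have telescope: "g k - g (k + 1) = (1 - qvar ^ a) * (f k + f (- k))" for k
  proof -
    define c where "c = sign_weight 0 k * inv_qfact (int a + k) * inv_qfact (int a - k)"
    have "g k = c * (1 - qvar powi (int a + k))"
      by (simp add: g_def c_def inv_qfact_minus_one)
    then have 1: "g k = c * (1 - qvar ^ a * qvar powi k)"
      by (simp add: power_int_add)
    have 2: "inv_qfact (int a - (k + 1)) = (1 - qvar powi (int a - k)) * inv_qfact (int a - k)"
      by (subst inv_qfact_minus_one [symmetric]) (simp add: diff_diff_eq)
    have "g (k + 1) = - (c * (qvar powi k - qvar powi k * qvar powi (int a - k)))"
      unfolding g_def 2 shift c_def by (simp add: algebra_simps)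
    then have 3: "g (k + 1) = - (c * (qvar powi k - qvar ^ a))"
      by (simp add: power_int_diff)
    have 4: "f k + f (- k) = c * (1 + qvar powi k)"
      unfolding f_def reflect sym_inv_minus by (simp add: c_def sym_inv_def algebra_simps)
    show ?thesis
      unfolding 1 3 4 by (simp add: algebra_simps)
  qed
  have sum_g: "(\<Sum>k = - int a..int a. g k) = (\<Sum>k = - int a..int a. g (k + 1))"
  proof -
    have "(\<Sum>k = - int a..int a. g k) = (\<Sum>k = - int a + 1..int a. g k)"
      by (rule sum.mono_neutral_right) (auto simp: g_def inv_qfact_neg)
    also have "\<dots> = (\<Sum>k = - int a + 1..int a + 1. g k)"
      by (rule sum.mono_neutral_left) (auto simp: g_def inv_qfact_neg)
    also have "\<dots> = (\<Sum>k = - int a..int a. g (k + 1))"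
      by (rule sum.reindex_bij_witness [of _ "\<lambda>k. k + 1" "\<lambda>k. k - 1"]) auto
    finally show ?thesis .
  qed
  have sum_f: "(\<Sum>k = - int a..int a. f (- k)) = (\<Sum>k = - int a..int a. f k)"
    by (rule sum.reindex_bij_witness [of _ uminus uminus]) auto
  have "(\<Sum>k = - int a..int a. (1 - qvar ^ a) * (f k + f (- k))) = 0"
    unfolding telescope [symmetric] sum_subtractf sum_g by simp
  then have "(1 - qvar ^ a) * (2 * (\<Sum>k = - int a..int a. f k)) = 0"
    by (simp add: sum_distrib_left [symmetric] sum.distrib sum_f)
  moreover have "(1 - qvar ^ a) \<noteq> 0" "(2 :: ratfun) \<noteq> 0"
    using False by simp_all
  moreover have "alt_sum a [] 0 = (\<Sum>k = - int a..int a. f k)"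
    by (simp add: alt_sum_def f_def)
  ultimately show ?thesis
    using False by simp
qed

section \<open>Positivity by induction on the list\<close>

text \<open>The numerators along the open chain of entries, ended by the factorial of the last one.
  The prefactor of \<open>S\<close> cancels the edge closing the cycle and leaves the factorials of
  the two end entries.\<close>

fun path_prod :: "nat \<Rightarrow> nat list \<Rightarrow> ratfun" where
  "path_prod a [] = qfact a"
| "path_prod a (b # ns) = qfact (a + b) * path_prod b ns"

text \<open>Lowering the head from \<open>b\<close> to \<open>s\<close> costs one
  \<open>q\<close>-binomial: \<open>[b, s]\<close> for the empty list, \<open>[b+d, b-s]\<close> if
  \<open>d\<close> comes next.\<close>

lemma path_prod_descend:
  assumes "s \<le> b"
  shows "\<exists>c\<in>nonneg_polys. path_prod b ns * inv_qfact (int b - int s) = c * path_prod s ns"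
proof (cases ns)
  case Nil
  have "path_prod b ns * inv_qfact (int b - int s) = qbinom b (int s) * path_prod s ns"
    by (simp add: Nil qbinom_def)
  then show ?thesis
    by blast
next
  case (Cons d ds)
  have "int (b + d) - (int b - int s) = int (s + d)"
    by simp
  then have "path_prod b ns * inv_qfact (int b - int s) =
      qbinom (b + d) (int b - int s) * path_prod s ns"
    by (simp only: Cons qbinom_def inv_qfact_of_nat path_prod.simps) simp
  then show ?thesis
    by blast
qed

text \<open>Each merge shortens the list by one. It also lowers \<open>j\<close> by one unless
  \<open>j\<close> is already \<open>0\<close>, so the bound on \<open>j\<close> persists and the
  empty list is reached with \<open>j = 0\<close>.\<close>

lemma alt_sum_nonneg:
  assumes "j \<le> length ns"
  shows "qfact a * path_prod a ns * alt_sum a ns j \<in> nonneg_polys"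
  using assms
proof (induction ns arbitrary: a j)
  case Nil
  then show ?case
    by (auto simp: alt_sum_single)
next
  case (Cons b ns)
  \<comment> \<open>Polynomial weights are asked for only when \<open>s \<le> b\<close>: beyond that
    \<open>(a - s) (b - s)\<close> may be negative, but \<open>1 / (q)_(b-s)\<close> is
    zero.\<close>
  obtain w j' where j': "j' \<le> length ns"
    and w: "\<And>s. s \<le> a \<Longrightarrow> s \<le> b \<Longrightarrow> w s \<in> nonneg_polys"
    and merge: "qfact (a + b) * alt_sum a (b # ns) j =
      (\<Sum>s\<le>a. w s * inv_qfact (int a - int s) * inv_qfact (int b - int s) * alt_sum s ns j')"
  proof (cases j)
    case 0
    have "qvar powi ((int a - int s) * (int b - int s)) \<in> nonneg_polys" if "s \<le> a" "s \<le> b" for s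
      using that by (auto simp: power_int_def)
    moreover have "qfact (a + b) * alt_sum a (b # ns) j =
        (\<Sum>s\<le>a. qvar powi ((int a - int s) * (int b - int s)) *
          inv_qfact (int a - int s) * inv_qfact (int b - int s) * alt_sum s ns 0)"
      unfolding 0 by (rule alt_sum_merge_noshift)
    ultimately show ?thesis
      using that [of 0 "\<lambda>s. qvar powi ((int a - int s) * (int b - int s))"] by blast
  next
    case (Suc i)
    have "qfact (a + b) * alt_sum a (b # ns) j =
        (\<Sum>s\<le>a. qvar ^ (s ^ 2) * inv_qfact (int a - int s) * inv_qfact (int b - int s) * alt_sum s ns i)"
      unfolding Suc by (rule alt_sum_merge_shift)
    moreover have "i \<le> length ns"
      using Cons.prems Suc by simp
    ultimately show ?thesis
      using that [of i "\<lambda>s. qvar ^ (s ^ 2)"] by blast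
  qed
  have "qfact a * path_prod a (b # ns) * alt_sum a (b # ns) j =
      qfact a * path_prod b ns * (qfact (a + b) * alt_sum a (b # ns) j)"
    by simp
  also have "\<dots> = (\<Sum>s\<le>a. w s * (qfact a * inv_qfact (int a - int s)) *
      (path_prod b ns * inv_qfact (int b - int s)) * alt_sum s ns j')"
    unfolding merge by (simp add: sum_distrib_left mult_ac)
  also have "\<dots> \<in> nonneg_polys"
  proof (rule nonneg_polys_sum)
    fix s assume "s \<in> {..a}"
    show "w s * (qfact a * inv_qfact (int a - int s)) *
      (path_prod b ns * inv_qfact (int b - int s)) * alt_sum s ns j' \<in> nonneg_polys"
    proof (cases "s \<le> b")
      case True
      obtain c where c: "c \<in> nonneg_polys"
        "path_prod b ns * inv_qfact (int b - int s) = c * path_prod s ns"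
        using path_prod_descend [OF True] by blast
      \<comment> \<open>This supplies the factor \<open>qfact s\<close> that the induction
        hypothesis for \<open>s\<close> contains.\<close>
      have "qfact a * inv_qfact (int a - int s) = qbinom a (int s) * qfact s"
        by (simp add: qbinom_def)
      then have "w s * (qfact a * inv_qfact (int a - int s)) *
          (path_prod b ns * inv_qfact (int b - int s)) * alt_sum s ns j' =
          w s * qbinom a (int s) * c * (qfact s * path_prod s ns * alt_sum s ns j')"
        unfolding c by simp
      also have "\<dots> \<in> nonneg_polys"
        using \<open>s \<in> {..a}\<close> True by (intro nonneg_polys_mult w c Cons.IH j') auto
      finally show ?thesis .
    qed (auto simp: inv_qfact_neg)
  qed
  finally show ?case .
qed

section \<open>Translation back to \<open>S\<close>\<close>

lemma path_prod_map:
  "path_prod (n 0) (map n [1..<Suc m]) = (\<Prod>i<m. qfact (n i + n (Suc i))) * qfact (n m)"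
proof (induction m arbitrary: n)
  case (Suc m)
  have "map n [1..<Suc (Suc m)] = n 1 # map (\<lambda>i. n (Suc i)) [1..<Suc m]"
    by (simp add: upt_conv_Cons map_Suc_upt [symmetric] comp_def del: upt_Suc)
  then show ?case
    using Suc [of "\<lambda>i. n (Suc i)"] by (simp add: prod.lessThan_Suc_shift del: upt_Suc prod.lessThan_Suc)
qed simp

lemma S_eq_alt_sum:
  assumes "n (Suc (Suc m)) = n 1"
  defines "ns \<equiv> map (n \<circ> Suc) [1..<Suc m]"
  shows "S (Suc m) n j = qfact (n 1) * path_prod (n 1) ns * alt_sum (n 1) ns j"
proof -
  define Q where "Q = (\<Prod>i<m. qfact (n (Suc i) + n (Suc (Suc i))))"
  have path: "path_prod (n 1) ns = Q * qfact (n (Suc m))"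
    using path_prod_map [of "n \<circ> Suc" m] by (simp add: ns_def Q_def)
  have interval: "{1..Suc m} = Suc ` {..<Suc m}"
    by (simp add: image_Suc_lessThan)
  \<comment> \<open>The only use of cyclicity in the denominators: the factor of
    \<open>n (m + 2) = n 1\<close> moves from the end of the product to its front.\<close>
  have cyclic: "(\<Prod>i = 1..Suc m. inv_qfact (int (n (i + 1)) - k)) = (\<Prod>i = 1..Suc m. inv_qfact (int (n i) - k))" for k
  proof -
    have "(\<Prod>i = 1..Suc m. inv_qfact (int (n (i + 1)) - k)) =
        (\<Prod>i<m. inv_qfact (int (n (Suc (Suc i))) - k)) * inv_qfact (int (n (Suc (Suc m))) - k)"
      unfolding interval by (subst prod.reindex) auto
    also have "\<dots> = inv_qfact (int (n (Suc 0)) - k) * (\<Prod>i<m. inv_qfact (int (n (Suc (Suc i))) - k))"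
      using assms(1) by simp
    also have "\<dots> = (\<Prod>i = 1..Suc m. inv_qfact (int (n i) - k))"
      unfolding interval by (subst prod.reindex) (auto simp: prod.lessThan_Suc_shift simp del: prod.lessThan_Suc)
    finally show ?thesis .
  qed
  have prod_sym: "(\<Prod>i = 1..Suc m. sym_inv (n i) k) = sym_inv (n 1) k * (\<Prod>b\<leftarrow>ns. sym_inv b k)" for k
  proof -
    have "(\<Prod>b\<leftarrow>ns. sym_inv b k) = (\<Prod>i<m. sym_inv (n (Suc (Suc i))) k)"
      unfolding ns_def by (induction m) simp_all
    then show ?thesis
      unfolding interval by (subst prod.reindex) (auto simp: prod.lessThan_Suc_shift simp del: prod.lessThan_Suc)
  qed
  have prod_qfact: "(\<Prod>i = 1..Suc m. qfact (n i + n (i + 1))) = Q * qfact (n 1 + n (Suc m))"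
    unfolding interval by (subst prod.reindex) (auto simp: Q_def assms(1) add.commute)
  have "(\<Prod>i = 1..Suc m. qbinom (n i + n (i + 1)) (int (n i) + k)) =
      Q * qfact (n 1 + n (Suc m)) * (sym_inv (n 1) k * (\<Prod>b\<leftarrow>ns. sym_inv b k))" for k
  proof -
    have "(\<Prod>i = 1..Suc m. qbinom (n i + n (i + 1)) (int (n i) + k)) =
        (\<Prod>i = 1..Suc m. qfact (n i + n (i + 1))) * (\<Prod>i = 1..Suc m. inv_qfact (int (n i) + k)) *
        (\<Prod>i = 1..Suc m. inv_qfact (int (n (i + 1)) - k))"
      unfolding prod.distrib [symmetric] by (rule prod.cong) (simp_all add: qbinom_def)
    also have "\<dots> = (\<Prod>i = 1..Suc m. qfact (n i + n (i + 1))) * (\<Prod>i = 1..Suc m. sym_inv (n i) k)"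
      unfolding cyclic by (simp only: sym_inv_def prod.distrib mult.assoc)
    finally show ?thesis
      unfolding prod_sym prod_qfact .
  qed
  then have "S (Suc m) n j = inverse (qbinom (n 1 + n (Suc m)) (int (n 1))) *
      (Q * qfact (n 1 + n (Suc m)) * alt_sum (n 1) ns j)"
    unfolding S_def alt_sum_def sign_weight_def by (simp only: sum_distrib_left mult_ac)
  \<comment> \<open>The numerator here is the factorial of the closing edge and cancels against the
    same factor of the sum.\<close>
  moreover have "qbinom (n 1 + n (Suc m)) (int (n 1)) = qfact (n 1 + n (Suc m)) / (qfact (n 1) * qfact (n (Suc m)))"
    by (simp add: qbinom_def)
  ultimately show ?thesis
    unfolding path by simp
qed

theorem theorem1p3:
  fixes m j :: nat and n :: "nat \<Rightarrow> nat"
  assumes "m \<ge> 1"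
    and "\<And>i. 1 \<le> i \<Longrightarrow> i \<le> m \<Longrightarrow> n i > 0"
    and "n (m + 1) = n 1"
    and "j \<le> m - 1"
  shows "\<exists>p :: int poly. (\<forall>i. coeff p i \<ge> 0) \<and> S m n j = to_fract p"
proof -
  obtain m' where m: "m = Suc m'"
    using assms(1) by (cases m) auto
  have "S m n j = qfact (n 1) * path_prod (n 1) (map (n \<circ> Suc) [1..<Suc m']) *
      alt_sum (n 1) (map (n \<circ> Suc) [1..<Suc m']) j"
    unfolding m using assms(3) m by (intro S_eq_alt_sum) simp
  \<comment> \<open>The list holds the \<open>m - 1\<close> entries after the first, so its length
    is the given bound on \<open>j\<close>.\<close>
  also have "\<dots> \<in> nonneg_polys"
    using assms(4) m by (intro alt_sum_nonneg) simp
  finally show ?thesis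
    by (auto simp: nonneg_polys_def)
qed

end
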